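(* Let $T>0$, let $f:\mathbb{R}^n\times\mathbb{R}^m\to\mathbb{R}^n$, and consider the driftless system $$\dot{\mathbf{p}}(t) = v(t)\, f(\mathbf{p}(t),u(t)),$$ with state $\mathbf{p}(t)\in\mathbb{R}^n$ and control signals $v(t)\in\mathbb{R}$ and $u(t)\in\mathbb{R}^m$. This system is symmetric under the time-reversing control signals $$\bar v(t) = -v(T-t),\qquad \bar u(t)=u(T-t),\qquad t\in[0,T],$$ with the reversed state trajectory $\bar{\mathbf{p}}(t)=\mathbf{p}(T-t)$ as the result. That is: for all control signals $v:[0,T]\to\mathbb{R}$, $u:[0,T]\to\mathbb{R}^m$ and every differentiable $\mathbf{p}:[0,T]\to\mathbb{R}^n$ satisfying $\dot{\mathbf{p}}(t)=v(t)f(\mathbf{p}(t),u(t))$ for all $t\in[0,T]$, the function $\bar{\mathbf{p}}(t)=\mathbf{p}(T-t)$, $t\in[0,T]$, satisfies $$\dot{\bar{\mathbf{p}}}(t)=\bar v(t)\, f(\bar{\mathbf{p}}(t),\bar u(t))\quad\text{for all } t\in[0,T],$$ and goes from $\bar{\mathbf{p}}(0)=\mathbf{p}(T)$ to $\bar{\mathbf{p}}(T)=\mathbf{p}(0)$.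
   Context: A control system is called symmetric if any state trajectory that brings the system from an initial state to a final state can be reversed in time, and the system equations (kinematic constraints) also hold for the time-reversed trajectory going from the final state to the initial state. Derivatives at the endpoints $t=0$ and $t=T$ are understood as one-sided derivatives. *)

theory Defs
  imports "HOL-Analysis.Analysis"
begin

(* Signals and trajectories on [0,T] are total functions whose values outside [0,T] are irrelevant:
   the derivative is taken within {0..T}, so it is two-sided in the interior and one-sided at the
   endpoints. *)

definition driftless_trajectory ::
  "((real ^ 'n) \<times> (real ^ 'm) \<Rightarrow> real ^ 'n) \<Rightarrow> real \<Rightarrow> (real \<Rightarrow> real) \<Rightarrow> (real \<Rightarrow> real ^ 'm)
    \<Rightarrow> (real \<Rightarrow> real ^ 'n) \<Rightarrow> bool"
  where "driftless_trajectory f T v u p \<longleftrightarrow>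
    (\<forall>t\<in>{0..T}. (p has_vector_derivative v t *\<^sub>R f (p t, u t)) (at t within {0..T}))"

definition goes_from_to :: "real \<Rightarrow> (real \<Rightarrow> 'a) \<Rightarrow> 'a \<Rightarrow> 'a \<Rightarrow> bool"
  where "goes_from_to T p a b \<longleftrightarrow> p 0 = a \<and> p T = b"

definition time_reversal :: "real \<Rightarrow> (real \<Rightarrow> 'a) \<Rightarrow> real \<Rightarrow> 'a"
  where "time_reversal T g = (\<lambda>t. g (T - t))"

(* Rv and Ru are the rules producing the reversing control signals from the original ones. *)

definition symmetric_under ::
  "((real ^ 'n) \<times> (real ^ 'm) \<Rightarrow> real ^ 'n) \<Rightarrow> real
    \<Rightarrow> ((real \<Rightarrow> real) \<Rightarrow> real \<Rightarrow> real) \<Rightarrow> ((real \<Rightarrow> real ^ 'm) \<Rightarrow> real \<Rightarrow> real ^ 'm) \<Rightarrow> bool"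
  where "symmetric_under f T Rv Ru \<longleftrightarrow>
    (\<forall>v u p a b. driftless_trajectory f T v u p \<and> goes_from_to T p a b \<longrightarrow>
      driftless_trajectory f T (Rv v) (Ru u) (time_reversal T p) \<and>
      goes_from_to T (time_reversal T p) b a)"

end

theory Submission
  imports Defs
begin

text \<open>The reflection \<open>t \<mapsto> T - t\<close> has derivative \<open>- 1\<close>, so by the chain rule a reversed trajectory moves
  with the opposite of the original velocity. The system is driftless, that is, its right-hand side
  is linear in \<open>v\<close>, so this change of sign is absorbed by replacing \<open>v\<close> by \<open>- v\<close>.
  Since the reflection maps \<open>{0..T}\<close> onto itself, swapping its endpoints, the one-sided derivatives
  at the endpoints are covered by the same computation as the interior ones.\<close>

lemma has_vector_derivative_time_reversal:
  fixes p :: "real \<Rightarrow> 'a::real_normed_vector"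
  assumes "(p has_vector_derivative d) (at (T - t) within {0..T})"
  shows "(time_reversal T p has_vector_derivative - d) (at t within {0..T})"
proof -
  have reflection: "((\<lambda>t. T - t) has_vector_derivative - 1) (at t within {0..T})"
    by (auto intro!: derivative_eq_intros)
  have "(p has_vector_derivative d) (at (T - t) within (\<lambda>t. T - t) ` {0..T})"
    using assms by simp
  from vector_diff_chain_within[OF reflection this] show ?thesis
    by (simp add: time_reversal_def o_def)
qed

theorem theorem1:
  fixes f :: "(real ^ 'n) \<times> (real ^ 'm) \<Rightarrow> real ^ 'n" and T :: real
  assumes "T > 0"
  shows "symmetric_under f T (\<lambda>v t. - v (T - t)) (\<lambda>u t. u (T - t))"
  unfolding symmetric_under_def
proof (intro allI impI conjI; elim conjE)
  fix v :: "real \<Rightarrow> real" and u :: "real \<Rightarrow> real ^ 'm" and p :: "real \<Rightarrow> real ^ 'n" and a b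
  assume trajectory: "driftless_trajectory f T v u p" and ends: "goes_from_to T p a b"
  show "driftless_trajectory f T (\<lambda>t. - v (T - t)) (\<lambda>t. u (T - t)) (time_reversal T p)"
    unfolding driftless_trajectory_def
  proof
    fix t assume "t \<in> {0..T}"
    then have "T - t \<in> {0..T}" by simp
    with trajectory have
      "(p has_vector_derivative v (T - t) *\<^sub>R f (p (T - t), u (T - t))) (at (T - t) within {0..T})"
      unfolding driftless_trajectory_def by blast
    from has_vector_derivative_time_reversal[OF this]
    show "(time_reversal T p has_vector_derivative
        - v (T - t) *\<^sub>R f (time_reversal T p t, u (T - t))) (at t within {0..T})"
      by (simp add: time_reversal_def)
  qed
  show "goes_from_to T (time_reversal T p) b a"
    using ends by (simp add: goes_from_to_def time_reversal_def)
qed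

end
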